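(* The number of order types of $3\times3$ magic squares, i.e. the number of linear orderings of the nine cells that are induced by $3\times 3$ magic squares (with arbitrarily large entries), is $16$. Up to the $8$ symmetries of a magic square there are exactly two order types.
   Context: A $3\times3$ magic square (in the strong sense) is a $3\times 3$ matrix of pairwise distinct positive integers in which all three row sums, all three column sums and both diagonal sums are equal. Its order type is the linear ordering of the nine cells in order of increasing value of their entries. The symmetries are the $8$ symmetries (rotations and reflections) of the square. *)

theory Defs
  imports "HOL-Analysis.Analysis"
begin

text \<open>
  Rows and columns are indexed by \<open>1, 2, 3 :: 3\<close>. Arithmetic in the type \<open>3\<close> is modulo 3 (so
  \<open>3 = 0\<close>), hence \<open>4 - i\<close> is the index opposite to \<open>i\<close>: it swaps \<open>1\<close> and \<open>3\<close> and fixes \<open>2\<close>. The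
  order of the type \<open>3\<close> is never used.
\<close>

type_synonym cell = "3 \<times> 3"

definition magic_square :: "int ^ 3 ^ 3 \<Rightarrow> bool" where
  "magic_square A \<longleftrightarrow>
     (\<forall>i j. 0 < A $ i $ j) \<and>
     inj (\<lambda>(i, j). A $ i $ j) \<and>
     (\<exists>s. (\<forall>i. (\<Sum>j\<in>UNIV. A $ i $ j) = s) \<and>
          (\<forall>j. (\<Sum>i\<in>UNIV. A $ i $ j) = s) \<and>
          (\<Sum>i\<in>UNIV. A $ i $ i) = s \<and>
          (\<Sum>i\<in>UNIV. A $ i $ (4 - i)) = s)"

definition order_type :: "int ^ 3 ^ 3 \<Rightarrow> cell rel" where
  "order_type A = {((i, j), (k, l)). A $ i $ j \<le> A $ k $ l}"

definition magic_order_types :: "cell rel set" where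
  "magic_order_types = {r. linear_order r \<and> (\<exists>A. magic_square A \<and> r = order_type A)}"

text \<open>Clockwise rotation by a quarter turn, and reflection in the main diagonal.\<close>

definition quarter_turn :: "cell \<Rightarrow> cell" where
  "quarter_turn = (\<lambda>(i, j). (j, 4 - i))"

definition reflection :: "cell \<Rightarrow> cell" where
  "reflection = (\<lambda>(i, j). (j, i))"

definition square_symmetries :: "(cell \<Rightarrow> cell) set" where
  "square_symmetries =
     {quarter_turn ^^ n |n. n < 4} \<union> {reflection \<circ> quarter_turn ^^ n |n. n < 4}"

definition symmetry_equiv :: "cell rel rel" where
  "symmetry_equiv =
     {(r, r'). r \<in> magic_order_types \<and> r' \<in> magic_order_types \<and>
               (\<exists>\<sigma>\<in>square_symmetries. r' = map_prod \<sigma> \<sigma> ` r)}"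

lemma square_symmetries_explicit:
  "square_symmetries =
     {\<lambda>(i, j). (i, j), \<lambda>(i, j). (j, 4 - i), \<lambda>(i, j). (4 - i, 4 - j), \<lambda>(i, j). (4 - j, i),
      \<lambda>(i, j). (j, i), \<lambda>(i, j). (4 - i, j), \<lambda>(i, j). (4 - j, 4 - i), \<lambda>(i, j). (i, 4 - j)}"
proof -
  have lt4: "{f n |n. n < (4::nat)} = {f 0, f 1, f 2, f 3}" for f :: "nat \<Rightarrow> cell \<Rightarrow> cell"
    by (auto simp: less_Suc_eq numeral_eq_Suc)
  have q: "quarter_turn ^^ 0 = (\<lambda>(i, j). (i, j))" "quarter_turn ^^ 1 = (\<lambda>(i, j). (j, 4 - i))"
    "quarter_turn ^^ 2 = (\<lambda>(i, j). (4 - i, 4 - j))" "quarter_turn ^^ 3 = (\<lambda>(i, j). (4 - j, i))"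
    by (auto simp: quarter_turn_def fun_eq_iff numeral_eq_Suc)
  have r: "reflection \<circ> (\<lambda>(i, j). (i, j)) = (\<lambda>(i, j). (j, i))"
    "reflection \<circ> (\<lambda>(i, j). (j, 4 - i)) = (\<lambda>(i, j). (4 - i, j))"
    "reflection \<circ> (\<lambda>(i, j). (4 - i, 4 - j)) = (\<lambda>(i, j). (4 - j, 4 - i))"
    "reflection \<circ> (\<lambda>(i, j). (4 - j, i)) = (\<lambda>(i, j). (i, 4 - j))"
    by (auto simp: reflection_def fun_eq_iff)
  show ?thesis
    unfolding square_symmetries_def lt4 q r by (simp only: Un_insert_left Un_empty_left)
qed

lemma card_square_symmetries: "card square_symmetries = 8"
proof -
  have "distinct (map (\<lambda>f. (f (1, 1), f (1, 2)))
     [\<lambda>(i, j). (i, j), \<lambda>(i, j). (j, 4 - i), \<lambda>(i, j). (4 - i, 4 - j), \<lambda>(i, j). (4 - j, i),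
      \<lambda>(i, j). (j, i), \<lambda>(i, j). (4 - i, j), \<lambda>(i, j). (4 - j, 4 - i), \<lambda>(i, j). (i :: 3, 4 - j :: 3)])"
    by simp
  then have "distinct
     [\<lambda>(i, j). (i, j), \<lambda>(i, j). (j, 4 - i), \<lambda>(i, j). (4 - i, 4 - j), \<lambda>(i, j). (4 - j, i),
      \<lambda>(i, j). (j, i), \<lambda>(i, j). (4 - i, j), \<lambda>(i, j). (4 - j, 4 - i), \<lambda>(i, j). (i :: 3, 4 - j :: 3)]"
    by (simp only: distinct_map)
  from distinct_card[OF this] show ?thesis
    by (simp only: square_symmetries_explicit list.set list.size)
qed

text \<open>Optional flips \<open>u\<close>, \<open>v\<close> of the two coordinates, followed by an optional transposition \<open>t\<close>.\<close>

definition flip_swap :: "bool \<Rightarrow> bool \<Rightarrow> bool \<Rightarrow> cell \<Rightarrow> cell" where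
  "flip_swap t u v = (\<lambda>(i, j).
     (if t then prod.swap else id) (if u then 4 - i else i, if v then 4 - j else j))"

lemma square_symmetries_flip_swap: "square_symmetries = {flip_swap t u v |t u v. True}"
proof -
  have e: "{flip_swap t u v |t u v. True} =
     {flip_swap False False False, flip_swap True False True, flip_swap False True True,
      flip_swap True True False, flip_swap True False False, flip_swap False True False,
      flip_swap True True True, flip_swap False False True}" (is "?L = ?R")
  proof
    show "?L \<subseteq> ?R"
    proof
      fix f assume "f \<in> ?L"
      then obtain t u v where "f = flip_swap t u v" by blast
      then show "f \<in> ?R" by (cases t; cases u; cases v; simp only: insert_iff simp_thms)
    qed
  qed blast
  have "flip_swap False False False = (\<lambda>(i, j). (i, j))"
    "flip_swap True False True = (\<lambda>(i, j). (4 - j, i))"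
    "flip_swap False True True = (\<lambda>(i, j). (4 - i, 4 - j))"
    "flip_swap True True False = (\<lambda>(i, j). (j, 4 - i))"
    "flip_swap True False False = (\<lambda>(i, j). (j, i))"
    "flip_swap False True False = (\<lambda>(i, j). (4 - i, j))"
    "flip_swap True True True = (\<lambda>(i, j). (4 - j, 4 - i))"
    "flip_swap False False True = (\<lambda>(i, j). (i, 4 - j))"
    by (auto simp: flip_swap_def fun_eq_iff)
  then show ?thesis
    by (simp only: e square_symmetries_explicit insert_commute)
qed

lemma flip_swap_comp:
  "flip_swap t u v \<circ> flip_swap t' u' v' =
     flip_swap (t \<noteq> t') (u' \<noteq> (if t' then v else u)) (v' \<noteq> (if t' then u else v))"
  by (cases t'; cases t) (auto simp: flip_swap_def fun_eq_iff)

lemma square_symmetries_comp: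
  "\<sigma> \<in> square_symmetries \<Longrightarrow> \<tau> \<in> square_symmetries \<Longrightarrow> \<sigma> \<circ> \<tau> \<in> square_symmetries"
  unfolding square_symmetries_flip_swap using flip_swap_comp by blast

lemma square_symmetries_inverse:
  assumes "\<sigma> \<in> square_symmetries"
  shows "\<exists>\<tau>\<in>square_symmetries. \<tau> \<circ> \<sigma> = id"
proof -
  obtain t u v where \<sigma>: "\<sigma> = flip_swap t u v"
    using assms unfolding square_symmetries_flip_swap by blast
  have "flip_swap t (if t then v else u) (if t then u else v) \<circ> \<sigma> = flip_swap False False False"
    unfolding \<sigma> flip_swap_comp by simp
  also have "\<dots> = id"
    by (simp add: flip_swap_def fun_eq_iff)
  finally show ?thesis
    unfolding square_symmetries_flip_swap by blast
qed

lemma equiv_symmetry_equiv: "equiv magic_order_types symmetry_equiv"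
proof (rule equivI)
  show "symmetry_equiv \<subseteq> magic_order_types \<times> magic_order_types"
    by (auto simp: symmetry_equiv_def)
  have "id \<in> square_symmetries"
    by (simp add: square_symmetries_explicit id_def case_prod_beta)
  then show "refl_on magic_order_types symmetry_equiv"
    by (auto simp: refl_on_def symmetry_equiv_def map_prod.id intro!: bexI[of _ id])
  show "sym symmetry_equiv"
  proof (rule symI)
    fix r r' assume r: "(r, r') \<in> symmetry_equiv"
    then obtain \<sigma> where \<sigma>: "\<sigma> \<in> square_symmetries" "r' = map_prod \<sigma> \<sigma> ` r"
      by (auto simp: symmetry_equiv_def)
    then obtain \<tau> where \<tau>: "\<tau> \<in> square_symmetries" "\<tau> \<circ> \<sigma> = id"
      using square_symmetries_inverse by blast
    have "map_prod \<tau> \<tau> ` r' = r"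
      using \<tau>(2) by (simp add: \<sigma>(2) image_comp map_prod_compose[symmetric] map_prod.id)
    with r \<tau>(1) show "(r', r) \<in> symmetry_equiv"
      by (auto simp: symmetry_equiv_def)
  qed
  show "trans symmetry_equiv"
  proof (rule transI)
    fix r s t assume *: "(r, s) \<in> symmetry_equiv" "(s, t) \<in> symmetry_equiv"
    then obtain \<sigma> \<tau> where \<sigma>: "\<sigma> \<in> square_symmetries" "s = map_prod \<sigma> \<sigma> ` r"
      and \<tau>: "\<tau> \<in> square_symmetries" "t = map_prod \<tau> \<tau> ` s"
      by (auto simp: symmetry_equiv_def)
    have "t = map_prod (\<tau> \<circ> \<sigma>) (\<tau> \<circ> \<sigma>) ` r"
      by (simp add: \<sigma>(2) \<tau>(2) image_comp map_prod_compose)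
    with * square_symmetries_comp[OF \<tau>(1) \<sigma>(1)] show "(r, t) \<in> symmetry_equiv"
      by (auto simp: symmetry_equiv_def)
  qed
qed

end

(* Every 3x3 magic square has Lucas's form with centre c and corner offsets x, y. Up to the
   symmetries of the square, which act on (x, y) by swapping the offsets and changing their signs,
   one has x > y > 0, and then x + y > x > max y (x - y) > 0. The only comparison left open is that
   of y with x - y, whose two outcomes occur for (x, y) = (3, 1) and (x, y) = (3, 2). *)
theory Submission
  imports Defs
begin

section \<open>Lucas's parametrisation of magic squares\<close>

definition lucas_square :: "int \<Rightarrow> int \<Rightarrow> int \<Rightarrow> int ^ 3 ^ 3" where
  "lucas_square c x y =
     vector [vector [c + x, c - x - y, c + y],
             vector [c - x + y, c, c + x - y],
             vector [c - y, c + x + y, c - x]]"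

abbreviation lucas_order :: "int \<Rightarrow> int \<Rightarrow> int \<Rightarrow> cell rel" where
  "lucas_order c x y \<equiv> order_type (lucas_square c x y)"

text \<open>The orbit relation of the eight signed permutations of two coordinates.\<close>

definition same_offsets :: "int \<Rightarrow> int \<Rightarrow> int \<Rightarrow> int \<Rightarrow> bool" where
  "same_offsets x y x' y' \<longleftrightarrow> \<bar>x'\<bar> = \<bar>x\<bar> \<and> \<bar>y'\<bar> = \<bar>y\<bar> \<or> \<bar>x'\<bar> = \<bar>y\<bar> \<and> \<bar>y'\<bar> = \<bar>x\<bar>"

lemma lucas_square_nth:
  "lucas_square c x y $ 1 $ 1 = c + x" "lucas_square c x y $ 1 $ 2 = c - x - y"
  "lucas_square c x y $ 1 $ 3 = c + y" "lucas_square c x y $ 2 $ 1 = c - x + y"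
  "lucas_square c x y $ 2 $ 2 = c" "lucas_square c x y $ 2 $ 3 = c + x - y"
  "lucas_square c x y $ 3 $ 1 = c - y" "lucas_square c x y $ 3 $ 2 = c + x + y"
  "lucas_square c x y $ 3 $ 3 = c - x"
  by (simp_all add: lucas_square_def)

lemma order_type_iff: "((i, j), (k, l)) \<in> order_type A \<longleftrightarrow> A $ i $ j \<le> A $ k $ l"
  by (simp add: order_type_def)

lemma order_type_cong:
  assumes "\<And>i j k l. A $ i $ j \<le> A $ k $ l \<longleftrightarrow> B $ i $ j \<le> B $ k $ l"
  shows "order_type A = order_type B"
  using assms by (simp add: order_type_def)

lemma linear_order_order_type:
  assumes "inj (\<lambda>(i, j). A $ i $ j)"
  shows "linear_order (order_type A)"
  using assms
  by (auto simp: linear_order_on_def partial_order_on_def preorder_on_def refl_on_def trans_def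
      antisym_def total_on_def order_type_def inj_def)

text \<open>A pair of offsets on any of these eight lines through the origin makes two cells equal:
  the centre and a corner, two corners, or, where the factor 2 appears, a corner and an edge
  cell.\<close>

lemma magic_square_offsets:
  assumes "magic_square (lucas_square c x y)"
  shows "x \<noteq> 0" "y \<noteq> 0" "\<bar>x\<bar> \<noteq> \<bar>y\<bar>" "\<bar>x\<bar> \<noteq> 2 * \<bar>y\<bar>" "\<bar>y\<bar> \<noteq> 2 * \<bar>x\<bar>"
proof -
  have inj: "\<And>i j k l. lucas_square c x y $ i $ j = lucas_square c x y $ k $ l \<Longrightarrow> i = k \<and> j = l"
    using assms by (auto simp: magic_square_def inj_def)
  have "x \<noteq> 0" "y \<noteq> 0" "x \<noteq> y" "x \<noteq> - y" "x \<noteq> 2 * y" "x \<noteq> - 2 * y" "y \<noteq> 2 * x"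
    "y \<noteq> - 2 * x"
    using inj[of 1 1 2 2] inj[of 1 3 2 2] inj[of 1 1 1 3] inj[of 1 1 3 1] inj[of 1 3 2 3]
      inj[of 3 1 3 2] inj[of 1 1 2 1] inj[of 3 3 3 2]
    by (auto simp: lucas_square_nth)
  then show "x \<noteq> 0" "y \<noteq> 0" "\<bar>x\<bar> \<noteq> \<bar>y\<bar>" "\<bar>x\<bar> \<noteq> 2 * \<bar>y\<bar>" "\<bar>y\<bar> \<noteq> 2 * \<bar>x\<bar>"
    by (auto simp: abs_if split: if_splits)
qed

text \<open>The middle row, the middle column and the two diagonals cover every cell once and the
  centre three more times, so \<open>4 * s = 3 * s + 3 * c\<close> and \<open>s = 3 * c\<close>. The
  centre and two adjacent corners then determine everything else.\<close>

lemma magic_square_is_lucas_square: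
  assumes "magic_square A"
  shows "\<exists>c x y. A = lucas_square c x y"
proof -
  obtain s where "\<forall>i. (\<Sum>j\<in>UNIV. A $ i $ j) = s" "\<forall>j. (\<Sum>i\<in>UNIV. A $ i $ j) = s"
    "(\<Sum>i\<in>UNIV. A $ i $ i) = s" "(\<Sum>i\<in>UNIV. A $ i $ (4 - i)) = s"
    using assms by (auto simp: magic_square_def)
  then have "A = lucas_square (A $ 2 $ 2) (A $ 1 $ 1 - A $ 2 $ 2) (A $ 1 $ 3 - A $ 2 $ 2)"
    unfolding vec_eq_iff by (simp add: forall_3 sum_3 lucas_square_nth)
  then show ?thesis by blast
qed

lemma magic_order_types_lucas:
  "magic_order_types = {lucas_order c x y |c x y. magic_square (lucas_square c x y)}"
proof (intro equalityI subsetI)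
  fix r assume "r \<in> magic_order_types"
  then show "r \<in> {lucas_order c x y |c x y. magic_square (lucas_square c x y)}"
    unfolding magic_order_types_def using magic_square_is_lucas_square by blast
next
  fix r assume "r \<in> {lucas_order c x y |c x y. magic_square (lucas_square c x y)}"
  then obtain c x y where "r = lucas_order c x y" "magic_square (lucas_square c x y)" by blast
  moreover from this(2) have "linear_order (lucas_order c x y)"
    unfolding magic_square_def by (blast intro: linear_order_order_type)
  ultimately show "r \<in> magic_order_types" unfolding magic_order_types_def by blast
qed

section \<open>The action of the symmetries on offsets\<close>

lemma order_type_image:
  assumes "surj \<sigma>" and "\<And>i j. (case \<sigma> (i, j) of (k, l) \<Rightarrow> B $ k $ l) = A $ i $ j"
  shows "map_prod \<sigma> \<sigma> ` order_type A = order_type B"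
proof -
  have e: "(\<sigma> p, \<sigma> q) \<in> order_type B \<longleftrightarrow> (p, q) \<in> order_type A" for p q
    using assms(2)[of "fst p" "snd p"] assms(2)[of "fst q" "snd q"]
    by (cases p; cases q) (auto simp: order_type_def split: prod.splits)
  show ?thesis
  proof
    show "order_type B \<subseteq> map_prod \<sigma> \<sigma> ` order_type A"
    proof
      fix z assume z: "z \<in> order_type B"
      obtain p q where "z = (\<sigma> p, \<sigma> q)"
        using \<open>surj \<sigma>\<close> by (metis surjD surj_pair)
      with z e show "z \<in> map_prod \<sigma> \<sigma> ` order_type A"
        by (auto intro!: image_eqI[of _ _ "(p, q)"])
    qed
  qed (use e in auto)
qed

lemma surj_flip_swap: "surj (flip_swap t u v)"
proof -
  \<comment> \<open>Moving a transposition past the flips interchanges row and column flips, hence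
    \<open>u\<close> and \<open>v\<close> change places in the inverse when \<open>t\<close>
    holds.\<close>
  have "flip_swap t u v \<circ> flip_swap t (if t then v else u) (if t then u else v)
      = flip_swap False False False"
    unfolding flip_swap_comp by simp
  also have "\<dots> = id"
    by (simp add: flip_swap_def fun_eq_iff)
  finally show ?thesis
    by (metis comp_apply id_apply surj_def)
qed

text \<open>The new offsets are read off the cells (1, 1) and (1, 3). The flips decide which old
  corners land there; the transposition fixes (1, 1) and exchanges (1, 3) with (3, 1), which negates
  the second offset.\<close>

lemma flip_swap_lucas_order:
  "map_prod (flip_swap t u v) (flip_swap t u v) ` lucas_order c x y =
     lucas_order c (if u then if v then - x else - y else if v then y else x)
       ((if t then - 1 else 1) * (if u then if v then - y else - x else if v then x else y))"
proof (rule order_type_image[OF surj_flip_swap])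
  show "(case flip_swap t u v (i, j) of (k, l) \<Rightarrow>
      lucas_square c (if u then if v then - x else - y else if v then y else x)
       ((if t then - 1 else 1) * (if u then if v then - y else - x else if v then x else y)) $ k $ l)
      = lucas_square c x y $ i $ j" for i j
    using exhaust_3[of i] exhaust_3[of j]
    by (cases t; cases u; cases v) (auto simp: flip_swap_def lucas_square_nth)
qed

lemma symmetry_lucas_order:
  assumes "\<sigma> \<in> square_symmetries"
  shows "\<exists>x' y'. same_offsets x y x' y' \<and> map_prod \<sigma> \<sigma> ` lucas_order c x y = lucas_order c x' y'"
proof -
  obtain t u v where \<sigma>: "\<sigma> = flip_swap t u v"
    using assms unfolding square_symmetries_flip_swap by blast
  show ?thesis
    unfolding \<sigma> flip_swap_lucas_order
    by (intro exI conjI) (auto simp: same_offsets_def)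
qed

text \<open>The flips alone produce (x, y), (y, x), (-x, -y) and (-y, -x); the sign contributed by
  \<open>t\<close> completes these to all eight signed permutations.\<close>

lemma same_offsets_symmetry:
  assumes "same_offsets x y x' y'"
  shows "\<exists>\<sigma>\<in>square_symmetries. map_prod \<sigma> \<sigma> ` lucas_order c x y = lucas_order c x' y'"
proof -
  have "\<exists>t u v. (if u then if v then - x else - y else if v then y else x) = x' \<and>
     (if t then - 1 else 1) * (if u then if v then - y else - x else if v then x else y) = y'"
    using assms unfolding ex_bool_eq by (auto simp: same_offsets_def abs_if split: if_splits)
  then show ?thesis
    using flip_swap_lucas_order unfolding square_symmetries_flip_swap by blast
qed

section \<open>The sixteen order types\<close>

lemma lucas_order_normal:
  assumes "0 < y" "y < x" "x \<noteq> 2 * y"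
  shows "lucas_order c x y = lucas_order 6 3 (if 2 * y < x then 1 else 2)"
proof -
  \<comment> \<open>The centre cancels from every comparison of cells, so it can be replaced by 6;
    each side of the line \<open>x = 2 * y\<close> fixes all comparisons.\<close>
  have "2 * y < x \<or> x < 2 * y" using assms by linarith
  then have "\<forall>i j k l. lucas_square c x y $ i $ j \<le> lucas_square c x y $ k $ l \<longleftrightarrow>
      lucas_square 6 3 (if 2 * y < x then 1 else 2) $ i $ j
        \<le> lucas_square 6 3 (if 2 * y < x then 1 else 2) $ k $ l"
    using assms(1,2) by (elim disjE) (simp_all add: forall_3 lucas_square_nth)
  then show ?thesis by (intro order_type_cong) blast
qed

text \<open>The orbit of (3, k), listed outright so that claims about it become finite
  computations.\<close>

definition small_offsets :: "int \<Rightarrow> (int \<times> int) set" where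
  "small_offsets k = {(3, k), (3, - k), (- 3, k), (- 3, - k), (k, 3), (k, - 3), (- k, 3), (- k, - 3)}"

lemma same_offsets_small: "same_offsets 3 k x y \<longleftrightarrow> (x, y) \<in> small_offsets k"
  by (auto simp: same_offsets_def small_offsets_def abs_if)

text \<open>The centre 6 is the least one that serves both orbits: for offsets 3 and 2 the smallest
  entry is 6 - 5 = 1. The common sum is 3 * 6 = 18.\<close>

lemma magic_square_small_offsets:
  assumes "(x, y) \<in> small_offsets 1 \<union> small_offsets 2"
  shows "magic_square (lucas_square 6 x y)"
proof -
  have "\<forall>(x, y)\<in>small_offsets 1 \<union> small_offsets 2. inj (\<lambda>(i, j). lucas_square 6 x y $ i $ j)"
    unfolding inj_def split_paired_All forall_3 prod.case lucas_square_nth small_offsets_def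
    by simp
  with assms have "inj (\<lambda>(i, j). lucas_square 6 x y $ i $ j)" by blast
  moreover have "\<forall>(x, y)\<in>small_offsets 1 \<union> small_offsets 2. \<forall>i j. 0 < lucas_square 6 x y $ i $ j"
    unfolding forall_3 lucas_square_nth small_offsets_def by simp
  with assms have "\<forall>i j. 0 < lucas_square 6 x y $ i $ j" by blast
  moreover have "\<exists>s. (\<forall>i. (\<Sum>j\<in>UNIV. lucas_square 6 x y $ i $ j) = s) \<and>
          (\<forall>j. (\<Sum>i\<in>UNIV. lucas_square 6 x y $ i $ j) = s) \<and>
          (\<Sum>i\<in>UNIV. lucas_square 6 x y $ i $ i) = s \<and>
          (\<Sum>i\<in>UNIV. lucas_square 6 x y $ i $ (4 - i)) = s"
    by (rule exI[of _ 18]) (simp add: forall_3 sum_3 lucas_square_nth)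
  ultimately show ?thesis unfolding magic_square_def by blast
qed

lemma magic_order_types_eq:
  "magic_order_types = case_prod (lucas_order 6) ` (small_offsets 1 \<union> small_offsets 2)"
proof (intro equalityI subsetI)
  fix r assume "r \<in> magic_order_types"
  then obtain c x y where r: "r = lucas_order c x y" and "magic_square (lucas_square c x y)"
    by (auto simp: magic_order_types_lucas)
  note neq = magic_square_offsets[OF this(2)]
  \<comment> \<open>\<open>a\<close> and \<open>b\<close> are the larger and the smaller absolute
    value of the offsets.\<close>
  obtain a b where ab: "0 < b" "b < a" "a \<noteq> 2 * b" "same_offsets a b x y"
  proof (cases "\<bar>x\<bar> < \<bar>y\<bar>")
    case True
    with neq that[where a = "\<bar>y\<bar>" and b = "\<bar>x\<bar>"] show ?thesis by (simp add: same_offsets_def)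
  next
    case False
    with neq that[where a = "\<bar>x\<bar>" and b = "\<bar>y\<bar>"] show ?thesis by (simp add: same_offsets_def)
  qed
  define k :: int where "k = (if 2 * b < a then 1 else 2)"
  \<comment> \<open>The symmetry leads from the normal form to \<open>r\<close>, so it still yields
    \<open>r\<close> once the normal form is replaced by the representative (3, k) with centre
    6.\<close>
  obtain \<sigma> where \<sigma>: "\<sigma> \<in> square_symmetries" "map_prod \<sigma> \<sigma> ` lucas_order c a b = r"
    using same_offsets_symmetry[OF ab(4)] r by blast
  moreover have "lucas_order c a b = lucas_order 6 3 k"
    unfolding k_def using ab(1-3) by (rule lucas_order_normal)
  ultimately obtain x' y' where "same_offsets 3 k x' y'" "r = lucas_order 6 x' y'"
    using symmetry_lucas_order[OF \<sigma>(1), of 3 k 6] by auto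
  moreover from this(1) have "(x', y') \<in> small_offsets 1 \<union> small_offsets 2"
    unfolding same_offsets_small k_def by (simp split: if_splits)
  ultimately show "r \<in> case_prod (lucas_order 6) ` (small_offsets 1 \<union> small_offsets 2)"
    by blast
next
  fix r assume "r \<in> case_prod (lucas_order 6) ` (small_offsets 1 \<union> small_offsets 2)"
  then obtain x y where "r = lucas_order 6 x y" "(x, y) \<in> small_offsets 1 \<union> small_offsets 2"
    by auto
  then show "r \<in> magic_order_types"
    unfolding magic_order_types_lucas using magic_square_small_offsets by blast
qed

text \<open>The eight lines of \<open>magic_square_offsets\<close> cut the plane into 16 sectors,
  and each sector contains exactly one of the 16 pairs. The order type tells on which side of each
  line a pair lies.\<close>

lemma inj_on_lucas_order:
  "inj_on (case_prod (lucas_order 6)) (small_offsets 1 \<union> small_offsets 2)"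
proof (rule inj_onI)
  \<comment> \<open>One test per line, each written as a comparison of two cells with the centre
    cancelled.\<close>
  let ?f = "\<lambda>(x :: int, y).
    [x \<le> 0, y \<le> 0, x \<le> y, x \<le> - y, x - y \<le> y, x + y \<le> - y, x \<le> y - x, - x \<le> x + y]"
  have inj: "inj_on ?f (small_offsets 1 \<union> small_offsets 2)"
    unfolding inj_on_def small_offsets_def by simp
  fix p p'
  assume p: "p \<in> small_offsets 1 \<union> small_offsets 2" "p' \<in> small_offsets 1 \<union> small_offsets 2"
    and eq: "case_prod (lucas_order 6) p = case_prod (lucas_order 6) p'"
  obtain x y x' y' where xy: "p = (x, y)" "p' = (x', y')" by fastforce
  have iff: "lucas_square 6 x y $ i $ j \<le> lucas_square 6 x y $ k $ l \<longleftrightarrow>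
      lucas_square 6 x' y' $ i $ j \<le> lucas_square 6 x' y' $ k $ l" for i j k l
    using eq unfolding xy prod.case by (metis order_type_iff)
  have "x \<le> 0 \<longleftrightarrow> x' \<le> 0" "y \<le> 0 \<longleftrightarrow> y' \<le> 0" "x \<le> y \<longleftrightarrow> x' \<le> y'" "x \<le> - y \<longleftrightarrow> x' \<le> - y'"
    "x - y \<le> y \<longleftrightarrow> x' - y' \<le> y'" "x + y \<le> - y \<longleftrightarrow> x' + y' \<le> - y'"
    "x \<le> y - x \<longleftrightarrow> x' \<le> y' - x'" "- x \<le> x + y \<longleftrightarrow> - x' \<le> x' + y'"
    using iff[of 1 1 2 2] iff[of 1 3 2 2] iff[of 1 1 1 3] iff[of 1 1 3 1]
      iff[of 2 3 1 3] iff[of 3 2 3 1] iff[of 1 1 2 1] iff[of 3 3 3 2]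
    unfolding lucas_square_nth by (smt (verit))+
  then have "?f p = ?f p'" unfolding xy prod.case by simp
  then show "p = p'" using inj_onD[OF inj] p by blast
qed

lemma card_magic_order_types: "card magic_order_types = 16"
  unfolding magic_order_types_eq card_image[OF inj_on_lucas_order]
  by (simp add: small_offsets_def)

section \<open>The two classes under the symmetries\<close>

lemma lucas_order_magic:
  assumes "k \<in> {1, 2}" "(x, y) \<in> small_offsets k"
  shows "lucas_order 6 x y \<in> magic_order_types"
  unfolding magic_order_types_eq by (rule image_eqI[of _ _ "(x, y)"]) (use assms in auto)

text \<open>Since an order type determines its small offsets by \<open>inj_on_lucas_order\<close>,
  equivalence of order types reduces to membership in an orbit of offsets.\<close>

lemma symmetry_equiv_lucas_order:
  assumes "k \<in> {1, 2}" "l \<in> {1, 2}" "(x, y) \<in> small_offsets l"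
  shows "(lucas_order 6 3 k, lucas_order 6 x y) \<in> symmetry_equiv \<longleftrightarrow> (x, y) \<in> small_offsets k"
proof
  assume "(lucas_order 6 3 k, lucas_order 6 x y) \<in> symmetry_equiv"
  then obtain \<sigma> where "\<sigma> \<in> square_symmetries"
    "lucas_order 6 x y = map_prod \<sigma> \<sigma> ` lucas_order 6 3 k"
    by (auto simp: symmetry_equiv_def)
  then obtain x' y' where "(x', y') \<in> small_offsets k" "lucas_order 6 x y = lucas_order 6 x' y'"
    using symmetry_lucas_order same_offsets_small by metis
  moreover from this have "(x, y) = (x', y')"
    using assms by (intro inj_onD[OF inj_on_lucas_order]) auto
  ultimately show "(x, y) \<in> small_offsets k" by simp
next
  assume "(x, y) \<in> small_offsets k"
  then obtain \<sigma> where "\<sigma> \<in> square_symmetries"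
    "map_prod \<sigma> \<sigma> ` lucas_order 6 3 k = lucas_order 6 x y"
    using same_offsets_symmetry same_offsets_small by metis
  moreover have "(3, k) \<in> small_offsets k" by (simp add: small_offsets_def)
  then have "lucas_order 6 3 k \<in> magic_order_types" "lucas_order 6 x y \<in> magic_order_types"
    using assms lucas_order_magic by blast+
  ultimately show "(lucas_order 6 3 k, lucas_order 6 x y) \<in> symmetry_equiv"
    unfolding symmetry_equiv_def by blast
qed

lemma card_magic_order_types_quotient: "card (magic_order_types // symmetry_equiv) = 2"
proof -
  let ?r = "lucas_order 6 3" and ?C = "\<lambda>k. symmetry_equiv `` {lucas_order 6 3 k}"
  have r: "?r 1 \<in> magic_order_types" "?r 2 \<in> magic_order_types"
    by (auto simp: small_offsets_def intro: lucas_order_magic[of 1] lucas_order_magic[of 2])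
  have "magic_order_types // symmetry_equiv = {?C 1, ?C 2}"
  proof (intro equalityI subsetI)
    fix X assume "X \<in> magic_order_types // symmetry_equiv"
    then obtain x y l where X: "X = symmetry_equiv `` {lucas_order 6 x y}"
      and l: "l \<in> {1, 2}" "(x, y) \<in> small_offsets l"
      unfolding magic_order_types_eq by (auto elim!: quotientE)
    then have "X = ?C l"
      using symmetry_equiv_lucas_order equiv_class_eq[OF equiv_symmetry_equiv] by metis
    with l show "X \<in> {?C 1, ?C 2}" by auto
  qed (use r in \<open>auto intro: quotientI\<close>)
  \<comment> \<open>The pair (3, 2) lies outside the orbit of (3, 1).\<close>
  moreover have "(?r 1, ?r 2) \<notin> symmetry_equiv"
    using symmetry_equiv_lucas_order[of 1 2 3 2] by (simp add: small_offsets_def)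
  then have "?C 1 \<noteq> ?C 2"
    using eq_equiv_class[OF _ equiv_symmetry_equiv r(2)] by blast
  ultimately show ?thesis by simp
qed

theorem mainTheorem7:
  shows "card magic_order_types = 16 \<and> card (magic_order_types // symmetry_equiv) = 2"
  using card_magic_order_types card_magic_order_types_quotient by blast

end
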